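(* Let $N\ge1$, let $S$ be an $N\times N$ matrix polynomial with $\det S\not\equiv0$, let $q$ be a scalar polynomial without zeros on the unit circle $\mathbb{T}$, and let $A(t)=S(t)/q(t)$. Let $p_1,\dots,p_N$ be the diagonal polynomials of the Smith canonical form of $S$, let $t_1,\dots,t_r$ be the distinct zeros of $\det A$ on $\mathbb{T}$, and let the integers $\beta_{j,i}\ge0$ and $\kappa_j\in\mathbb{Z}$ $(1\le j\le N,\ 1\le i\le r)$ be defined by the representations $$\frac{p_j(t)}{q(t)}=(t-t_1)^{\beta_{j,1}}\cdots(t-t_r)^{\beta_{j,r}}\,t^{\kappa_j}\,r_j^-(t)\,r_j^+(t),$$ where $r_j^+$ and $r_j^-$ are rational functions having no zeros and no poles in $|t|\le1$ and in $1\le|t|\le\infty$, respectively. Suppose that $$\beta_{N,1}+\cdots+\beta_{N,r}+\kappa_N<0.$$ Then the condition numbers $\kappa(T_n(A))$ grow at least exponentially, i.e. there are positive constants $c,\gamma$ such that $\kappa(T_n(A))\ge c\,e^{\gamma n}$ for all $n\ge1$.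
   Context: Smith canonical form: $S(t)=G_+(t)\,\mathrm{diag}(p_1(t),\dots,p_N(t))\,H_+(t)$, where $G_+,H_+$ are matrix polynomials with constant nonzero determinants and $p_j$ are monic scalar polynomials with $p_{j-1}\mid p_j$ for $j=2,\dots,N$. Consequently $\beta_{1,i}\le\cdots\le\beta_{N,i}$ for each $i$ and $\kappa_1\le\cdots\le\kappa_N$, so that $\beta_{N,1}+\cdots+\beta_{N,r}+\kappa_N$ is the largest of the numbers $\beta_{j,1}+\cdots+\beta_{j,r}+\kappa_j$. With Fourier coefficients $\hat A_k=\frac1{2\pi}\int_0^{2\pi}A(e^{i\theta})e^{-ik\theta}\,d\theta$, $T_n(A)=(\hat A_{j-k})_{j,k=0}^{n-1}\in\mathbb{C}^{nN\times nN}$. For a square matrix $M$, $\kappa(M)=\|M\|\,\|M^{-1}\|$ with the spectral norm, and $\kappa(M)=\infty$ if $M$ is not invertible (not to be confused with the integers $\kappa_j$). *)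

theory Defs
  imports
    "HOL-Analysis.Analysis"
    "HOL-Computational_Algebra.Computational_Algebra"
    "HOL-Computational_Algebra.Field_as_Ring"
    "Jordan_Normal_Form.Determinant"
    "Jordan_Normal_Form.Gauss_Jordan_Elimination"
begin

hide_const (open) Finite_Cartesian_Product.mat Finite_Cartesian_Product.vec Determinants.det

text \<open>
  Matrices are those of the AFP entry Jordan-Normal-Form, because the size of the block Toeplitz
  matrices below varies with \<open>n\<close>. All indices start at \<open>0\<close>, so the diagonal \<open>p\<^sub>1, \<dots>, p\<^sub>N\<close>
  of a Smith form is \<open>p 0, \<dots>, p (N - 1)\<close>.
\<close>

definition is_smith_form :: "nat \<Rightarrow> complex poly mat \<Rightarrow> (nat \<Rightarrow> complex poly) \<Rightarrow> bool" where
  "is_smith_form N S p \<longleftrightarrow>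
     (\<exists>G\<in>carrier_mat N N. \<exists>H\<in>carrier_mat N N.
        (\<exists>c. c \<noteq> 0 \<and> det G = [:c:]) \<and> (\<exists>c. c \<noteq> 0 \<and> det H = [:c:]) \<and>
        S = G * mat_diag N p * H) \<and>
     (\<forall>j<N. lead_coeff (p j) = 1) \<and>
     (\<forall>j. Suc j < N \<longrightarrow> p j dvd p (Suc j))"

text \<open>
  Rational functions are elements of the fraction field of the polynomial ring;
  \<^const>\<open>quot_of_fract\<close> yields numerator and denominator in lowest terms.
\<close>

definition ratfun_zero :: "complex poly fract \<Rightarrow> complex \<Rightarrow> bool" where
  "ratfun_zero f z \<longleftrightarrow> poly (fst (quot_of_fract f)) z = 0"

definition ratfun_pole :: "complex poly fract \<Rightarrow> complex \<Rightarrow> bool" where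
  "ratfun_pole f z \<longleftrightarrow> poly (snd (quot_of_fract f)) z = 0"

definition ratfun_zero_infinity :: "complex poly fract \<Rightarrow> bool" where
  "ratfun_zero_infinity f \<longleftrightarrow>
     f = 0 \<or> degree (fst (quot_of_fract f)) < degree (snd (quot_of_fract f))"

definition ratfun_pole_infinity :: "complex poly fract \<Rightarrow> bool" where
  "ratfun_pole_infinity f \<longleftrightarrow>
     degree (snd (quot_of_fract f)) < degree (fst (quot_of_fract f))"

text \<open>The conditions imposed on the factors \<open>r\<^sup>+\<close> and \<open>r\<^sup>-\<close>, respectively.\<close>

definition plus_factor :: "complex poly fract \<Rightarrow> bool" where
  "plus_factor f \<longleftrightarrow> (\<forall>z. cmod z \<le> 1 \<longrightarrow> \<not> ratfun_zero f z \<and> \<not> ratfun_pole f z)"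

definition minus_factor :: "complex poly fract \<Rightarrow> bool" where
  "minus_factor f \<longleftrightarrow>
     (\<forall>z. 1 \<le> cmod z \<longrightarrow> \<not> ratfun_zero f z \<and> \<not> ratfun_pole f z) \<and>
     \<not> ratfun_zero_infinity f \<and> \<not> ratfun_pole_infinity f"

definition fourier_coeff :: "nat \<Rightarrow> (complex \<Rightarrow> complex mat) \<Rightarrow> int \<Rightarrow> complex mat" where
  "fourier_coeff N A k = mat N N (\<lambda>(a, b).
     integral {0..2 * pi} (\<lambda>\<theta>. (A (cis \<theta>) $$ (a, b)) * cis (- (of_int k * \<theta>))) / of_real (2 * pi))"

text \<open>Row \<open>j N + a\<close> of the block matrix is row \<open>a\<close> of block row \<open>j\<close>; likewise for columns.\<close>

definition block_toeplitz :: "nat \<Rightarrow> nat \<Rightarrow> (complex \<Rightarrow> complex mat) \<Rightarrow> complex mat" where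
  "block_toeplitz N n A = mat (n * N) (n * N) (\<lambda>(x, y).
     fourier_coeff N A (int (x div N) - int (y div N)) $$ (x mod N, y mod N))"

definition euclid_norm :: "complex vec \<Rightarrow> real" where
  "euclid_norm v = L2_set (\<lambda>i. cmod (vec_index v i)) {..<dim_vec v}"

definition spectral_norm :: "complex mat \<Rightarrow> real" where
  "spectral_norm M =
     Sup {euclid_norm (M *\<^sub>v v) | v. v \<in> carrier_vec (dim_col M) \<and> euclid_norm v \<le> 1}"

definition condition_number :: "complex mat \<Rightarrow> ereal" where
  "condition_number M =
     (if invertible_mat M
      then ereal (spectral_norm M * spectral_norm (the (mat_inverse M)))
      else \<infinity>)"

end

theory Submission
  imports Defs "HOL-Complex_Analysis.Cauchy_Integral_Formula"
begin

text \<open>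
  Since every \<open>p\<^sub>j\<close> divides \<open>p\<^sub>N\<close>, the Smith form \<open>S = G D H\<close> yields a polynomial matrix
  \<open>B = H\<^sup>-\<^sup>1 diag(p\<^sub>N / p\<^sub>j) G\<^sup>-\<^sup>1\<close> with \<open>S B = p\<^sub>N I\<close> (\<open>smith_last_annihilates\<close>). This removes
  the matrix structure from the problem: for the first column \<open>x\<close> of \<open>B\<close> and
  \<open>f = x / r\<^sub>N\<^sup>+\<close>, which is analytic on a neighbourhood of the closed disc, \<open>A f\<close> is the
  first unit vector times the scalar function
  \<open>(t - t\<^sub>1)\<^bsup>\<beta>\<^sub>N\<^sub>,\<^sub>1\<^esup> \<cdots> (t - t\<^sub>r)\<^bsup>\<beta>\<^sub>N\<^sub>,\<^sub>r\<^esup> t\<^bsup>\<kappa>\<^sub>N\<^esup> r\<^sub>N\<^sup>-\<close>. By the hypothesis on the exponents this function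
  vanishes at infinity, and its poles lie in the open disc (\<open>negative_index_splitting\<close>); hence its
  Fourier coefficients of nonnegative index are \<open>0\<close> (\<open>strictly_proper_fourier_eq_0\<close>). In other
  words, \<open>f\<close> lies in the kernel of the infinite Toeplitz operator with symbol \<open>A\<close>.

  The Taylor coefficients of \<open>f\<close> decay geometrically (\<open>rational_taylor_geometric\<close>), so cutting
  them off after \<open>n\<close> terms gives vectors \<open>v\<^sub>n\<close> whose norms stay away from \<open>0\<close> while
  \<open>\<parallel>T\<^sub>n(A) v\<^sub>n\<parallel>\<close> is exponentially small (\<open>toeplitz_truncated_kernel_small\<close>).
  If no \<open>T\<^sub>n(A)\<close> is invertible, all condition numbers are infinite. Otherwise some
  \<open>T\<^sub>n(A)\<close>, thus some Fourier coefficient of \<open>A\<close>, is nonzero, and this entry recurs in all larger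
  sections and bounds \<open>\<parallel>T\<^sub>n(A)\<parallel>\<close> from below. The theorem then follows from
  \<open>\<kappa>(M) \<ge> \<parallel>M u\<parallel> \<parallel>v\<parallel> / (\<parallel>u\<parallel> \<parallel>M v\<parallel>)\<close> (\<open>condition_number_ge_ratio\<close>).
\<close>

hide_const (open) Finite_Cartesian_Product.mat Finite_Cartesian_Product.vec Determinants.det

section \<open>Condition numbers\<close>

lemma euclid_norm_nonneg: "0 \<le> euclid_norm v"
  by (simp add: euclid_norm_def L2_set_nonneg)

lemma cmod_index_le_euclid_norm: "i < dim_vec v \<Longrightarrow> cmod (v $ i) \<le> euclid_norm v"
  unfolding euclid_norm_def by (rule member_le_L2_set) auto

lemma euclid_norm_le_sum: "euclid_norm v \<le> (\<Sum>i<dim_vec v. cmod (v $ i))"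
  unfolding euclid_norm_def by (rule L2_set_le_sum) auto

lemma euclid_norm_smult: "euclid_norm (c \<cdot>\<^sub>v v) = cmod c * euclid_norm v"
  unfolding euclid_norm_def
  by (subst L2_set_right_distrib) (auto simp: norm_mult intro!: L2_set_cong)

lemma euclid_norm_pos:
  assumes "v \<in> carrier_vec n" "v \<noteq> 0\<^sub>v n"
  shows "0 < euclid_norm v"
proof -
  obtain i where "i < n" "v $ i \<noteq> 0"
    using assms by (metis carrier_vecD eq_vecI index_zero_vec(1) zero_carrier_vec)
  then show ?thesis
    using cmod_index_le_euclid_norm[of i v] assms(1) by (smt (verit) carrier_vecD zero_less_norm_iff)
qed

lemma euclid_norm_unit_vec:
  assumes "i < n"
  shows "euclid_norm (unit_vec n i) = 1"
proof -
  have "(\<Sum>j<n. (cmod (unit_vec n i $ j))\<^sup>2) = (\<Sum>j<n. if j = i then 1 else 0)"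
    using assms by (intro sum.cong) auto
  then show ?thesis
    using assms by (simp add: euclid_norm_def L2_set_def)
qed

text \<open>
  The supremum that defines the spectral norm is a meaningful number only because of this bound:
  every coordinate of a vector in the unit ball has modulus at most \<open>1\<close>.
\<close>
lemma spectral_norm_bdd_above:
  "bdd_above {euclid_norm (M *\<^sub>v v) | v. v \<in> carrier_vec (dim_col M) \<and> euclid_norm v \<le> 1}"
proof (rule bdd_aboveI)
  fix x assume "x \<in> {euclid_norm (M *\<^sub>v v) | v. v \<in> carrier_vec (dim_col M) \<and> euclid_norm v \<le> 1}"
  then obtain v where v: "v \<in> carrier_vec (dim_col M)" "euclid_norm v \<le> 1"
    and x: "x = euclid_norm (M *\<^sub>v v)" by blast
  have "x \<le> (\<Sum>i<dim_row M. cmod ((M *\<^sub>v v) $ i))"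
    using euclid_norm_le_sum[of "M *\<^sub>v v"] x by simp
  also have "\<dots> \<le> (\<Sum>i<dim_row M. \<Sum>j<dim_col M. cmod (M $$ (i, j)))"
  proof (rule sum_mono)
    fix i assume i: "i \<in> {..<dim_row M}"
    have "(M *\<^sub>v v) $ i = (\<Sum>j<dim_col M. M $$ (i, j) * v $ j)"
      using i v(1) by (auto simp: scalar_prod_def atLeast0LessThan intro!: sum.cong)
    also have "cmod \<dots> \<le> (\<Sum>j<dim_col M. cmod (M $$ (i, j)) * 1)"
    proof (rule sum_norm_le)
      fix j assume "j \<in> {..<dim_col M}"
      then have "cmod (v $ j) \<le> 1"
        using cmod_index_le_euclid_norm[of j v] v by auto
      then show "cmod (M $$ (i, j) * v $ j) \<le> cmod (M $$ (i, j)) * 1"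
        unfolding norm_mult by (intro mult_left_mono) auto
    qed
    finally show "cmod ((M *\<^sub>v v) $ i) \<le> (\<Sum>j<dim_col M. cmod (M $$ (i, j)))" by simp
  qed
  finally show "x \<le> (\<Sum>i<dim_row M. \<Sum>j<dim_col M. cmod (M $$ (i, j)))" .
qed

lemma euclid_norm_mult_mat_vec_le:
  assumes v: "v \<in> carrier_vec (dim_col M)"
  shows "euclid_norm (M *\<^sub>v v) \<le> spectral_norm M * euclid_norm v"
proof (cases "v = 0\<^sub>v (dim_col M)")
  case True
  have "M *\<^sub>v v = 0\<^sub>v (dim_row M)" using True by (intro eq_vecI) auto
  then show ?thesis using True by (simp add: euclid_norm_def L2_set_def)
next
  case False
  let ?e = "euclid_norm v"
  have pos: "0 < ?e" using euclid_norm_pos[OF v False] .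
  let ?v = "complex_of_real (1 / ?e) \<cdot>\<^sub>v v"
  have "euclid_norm ?v = 1" using pos by (simp add: euclid_norm_smult norm_divide)
  then have "euclid_norm (M *\<^sub>v ?v) \<le> spectral_norm M"
    unfolding spectral_norm_def using v
    by (intro cSup_upper[OF _ spectral_norm_bdd_above]) (auto intro!: exI[of _ ?v])
  moreover have "M *\<^sub>v ?v = complex_of_real (1 / ?e) \<cdot>\<^sub>v (M *\<^sub>v v)"
    using v by (intro mult_mat_vec[of _ "dim_row M" "dim_col M"]) auto
  ultimately have "euclid_norm (M *\<^sub>v v) / ?e \<le> spectral_norm M"
    using pos by (simp add: euclid_norm_smult norm_divide)
  then show ?thesis using pos by (simp add: field_simps)
qed

lemma mat_inverse_of_invertible:
  fixes M :: "complex mat"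
  assumes M: "M \<in> carrier_mat n n" and inv: "invertible_mat M"
  obtains B where "mat_inverse M = Some B" "B \<in> carrier_mat n n" "B * M = 1\<^sub>m n"
proof (cases "mat_inverse M")
  case None
  obtain B where B: "M * B = 1\<^sub>m n" "B * M = 1\<^sub>m (dim_row B)"
    using inv M by (auto simp: invertible_mat_def inverts_mat_def)
  have "dim_col B = n" using arg_cong[OF B(1), of dim_col] by simp
  moreover have "dim_row B = n" using arg_cong[OF B(2), of dim_col] M by simp
  ultimately have "B \<in> carrier_mat n n" by auto
  with B M have "M \<in> Units (ring_mat TYPE(complex) n ())"
    by (auto simp: Units_def ring_mat_def)
  with mat_inverse(1)[OF M None, of "()"] show ?thesis by blast
next
  case (Some B)
  then show ?thesis using mat_inverse(2)[OF M Some] that by blast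
qed

text \<open>
  Lower bounds for condition numbers are read off from two test vectors: \<open>\<parallel>M u\<parallel> \<le> \<parallel>M\<parallel> \<parallel>u\<parallel>\<close>,
  and \<open>v = M\<^sup>-\<^sup>1 (M v)\<close> gives \<open>\<parallel>v\<parallel> \<le> \<parallel>M\<^sup>-\<^sup>1\<parallel> \<parallel>M v\<parallel>\<close>.
\<close>
lemma condition_number_ge_ratio:
  assumes M: "M \<in> carrier_mat n n" and inv: "invertible_mat M"
    and u: "u \<in> carrier_vec n" "u \<noteq> 0\<^sub>v n"
    and v: "v \<in> carrier_vec n" "v \<noteq> 0\<^sub>v n"
  shows "0 < euclid_norm (M *\<^sub>v v)"
    and "ereal (euclid_norm (M *\<^sub>v u) * euclid_norm v / (euclid_norm u * euclid_norm (M *\<^sub>v v)))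
      \<le> condition_number M"
proof -
  obtain B where B: "mat_inverse M = Some B" "B \<in> carrier_mat n n" "B * M = 1\<^sub>m n"
    using mat_inverse_of_invertible[OF M inv] .
  have vpos: "0 < euclid_norm v" and upos: "0 < euclid_norm u"
    using euclid_norm_pos u v by blast+
  have "B *\<^sub>v (M *\<^sub>v v) = v"
    using B M v by (subst assoc_mult_mat_vec[symmetric]) auto
  moreover have "euclid_norm (B *\<^sub>v (M *\<^sub>v v)) \<le> spectral_norm B * euclid_norm (M *\<^sub>v v)"
    using B M v by (intro euclid_norm_mult_mat_vec_le) auto
  ultimately have 1: "euclid_norm v \<le> spectral_norm B * euclid_norm (M *\<^sub>v v)" by simp
  then show Mv: "0 < euclid_norm (M *\<^sub>v v)"
    using vpos euclid_norm_nonneg[of "M *\<^sub>v v"]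
    by (metis less_eq_real_def mult_zero_right not_le)
  have 2: "euclid_norm (M *\<^sub>v u) \<le> spectral_norm M * euclid_norm u"
    using M u by (intro euclid_norm_mult_mat_vec_le) auto
  have "0 \<le> spectral_norm M * euclid_norm u"
    using 2 euclid_norm_nonneg[of "M *\<^sub>v u"] by linarith
  from mult_mono[OF 2 1 this] euclid_norm_nonneg[of v]
  have "euclid_norm (M *\<^sub>v u) * euclid_norm v
      \<le> (spectral_norm M * spectral_norm B) * (euclid_norm u * euclid_norm (M *\<^sub>v v))"
    by (simp add: ac_simps)
  then have "euclid_norm (M *\<^sub>v u) * euclid_norm v / (euclid_norm u * euclid_norm (M *\<^sub>v v))
      \<le> spectral_norm M * spectral_norm B"
    using upos Mv by (simp add: pos_divide_le_eq)
  then show "ereal (euclid_norm (M *\<^sub>v u) * euclid_norm v / (euclid_norm u * euclid_norm (M *\<^sub>v v)))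
      \<le> condition_number M"
    using inv B by (simp add: condition_number_def)
qed

lemma condition_number_ge_1:
  assumes M: "M \<in> carrier_mat n n" and "0 < n"
  shows "1 \<le> condition_number M"
proof (cases "invertible_mat M")
  case True
  let ?u = "unit_vec n 0 :: complex vec"
  have u: "?u \<in> carrier_vec n" "?u \<noteq> 0\<^sub>v n" using assms(2) by auto
  show ?thesis
    using condition_number_ge_ratio[OF M True u u] euclid_norm_unit_vec[OF assms(2)]
    by (simp add: one_ereal_def)
qed (simp add: condition_number_def)

section \<open>Rational functions on the unit circle\<close>

text \<open>
  The finitely many zeros of the denominator stay outside some circle of radius \<open>s > 1\<close>, on which
  the Taylor series of every quotient with this denominator converges; so its coefficients are
  \<open>O(s\<^sup>-\<^sup>k)\<close>. The ratio \<open>\<rho> = 1 / s\<close> depends on the denominator alone, which lets one \<open>\<rho>\<close>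
  serve all components of a vector of rational functions.
\<close>
lemma rational_taylor_geometric:
  fixes v :: "complex poly"
  assumes nz: "\<And>z. cmod z \<le> 1 \<Longrightarrow> poly v z \<noteq> 0"
  obtains \<rho> where "0 < \<rho>" "\<rho> < 1"
    "\<And>u. \<exists>a C. 0 \<le> C \<and> (\<forall>n z. cmod z \<le> 1 \<longrightarrow>
        cmod (poly u z / poly v z - (\<Sum>k<n. a k * z ^ k)) \<le> C * \<rho> ^ n)"
proof -
  have "v \<noteq> 0" using nz[of 0] by auto
  then have fin: "finite {z. poly v z = 0}" by (rule poly_roots_finite)
  define R where "R = Min (insert 2 (cmod ` {z. poly v z = 0}))"
  have R1: "1 < R"
    unfolding R_def using fin nz by (subst Min_gr_iff) (auto simp: not_le[symmetric])
  have R: "poly v z \<noteq> 0" if "cmod z < R" for z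
  proof
    assume "poly v z = 0"
    then have "R \<le> cmod z" unfolding R_def using fin by (intro Min_le) auto
    with that show False by simp
  qed
  define s where "s = (1 + R) / 2"
  have s: "1 < s" "s < R" using R1 by (auto simp: s_def)
  show ?thesis
  proof
    show "0 < 1 / s" "1 / s < 1" using s by auto
    fix u :: "complex poly"
    let ?F = "\<lambda>z. poly u z / poly v z"
    define a where "a k = (deriv ^^ k) ?F 0 / fact k" for k
    have hol: "?F holomorphic_on ball 0 R"
      using R by (intro holomorphic_intros) auto
    have sums: "(\<lambda>k. a k * z ^ k) sums ?F z" if "cmod z < R" for z
      using holomorphic_power_series[OF hol, of z] that by (simp add: a_def)
    have "summable (\<lambda>k. a k * complex_of_real s ^ k)"
      using sums[of "complex_of_real s"] s by (auto simp: sums_iff)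
    then have "Bseq (\<lambda>k. a k * complex_of_real s ^ k)"
      by (rule convergent_imp_Bseq[OF convergentI[OF summable_LIMSEQ_zero]])
    then obtain B where B: "0 < B" "\<And>k. cmod (a k * complex_of_real s ^ k) \<le> B"
      by (auto simp: Bseq_def)
    have ak: "cmod (a k) \<le> B * (1 / s) ^ k" for k
      using B(2)[of k] s by (simp add: norm_mult norm_power field_simps)
    have "cmod (?F z - (\<Sum>k<n. a k * z ^ k)) \<le> B / (1 - 1 / s) * (1 / s) ^ n"
      if z: "cmod z \<le> 1" for n z
    proof -
      have zR: "cmod z < R" using z R1 by simp
      have tail: "(\<lambda>k. a (k + n) * z ^ (k + n)) sums (?F z - (\<Sum>k<n. a k * z ^ k))"
        by (rule sums_iff_shift'[THEN iffD2, OF sums[OF zR]])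
      have term_le: "cmod (a (k + n) * z ^ (k + n)) \<le> B * (1 / s) ^ n * (1 / s) ^ k" for k
      proof -
        have "cmod (a (k + n) * z ^ (k + n)) \<le> (B * (1 / s) ^ (k + n)) * 1"
          unfolding norm_mult norm_power using ak z B s
          by (intro mult_mono power_le_one) auto
        then show ?thesis by (simp add: power_add mult_ac)
      qed
      have geo: "(\<lambda>k. B * (1 / s) ^ n * (1 / s) ^ k) sums (B * (1 / s) ^ n * (1 / (1 - 1 / s)))"
        using s by (intro sums_mult geometric_sums) auto
      have "cmod (\<Sum>k. a (k + n) * z ^ (k + n)) \<le> (\<Sum>k. B * (1 / s) ^ n * (1 / s) ^ k)"
        by (rule norm_suminf_le[OF term_le sums_summable[OF geo]])
      then show ?thesis
        using sums_unique[OF tail] sums_unique[OF geo] by (simp add: mult_ac)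
    qed
    moreover have "0 \<le> B / (1 - 1 / s)" using B s by simp
    ultimately show "\<exists>a C. 0 \<le> C \<and> (\<forall>n z. cmod z \<le> 1 \<longrightarrow>
        cmod (?F z - (\<Sum>k<n. a k * z ^ k)) \<le> C * (1 / s) ^ n)"
      by blast
  qed
qed

lemma integral_cis_eq_0:
  fixes k :: int
  assumes "k \<noteq> 0"
  shows "((\<lambda>\<theta>. cis (of_int k * \<theta>)) has_integral 0) {0..2 * pi}"
proof -
  have "((\<lambda>\<theta>. cis (of_int k * \<theta>)) has_integral
      (cis (of_int k * (2 * pi)) / (\<i> * of_int k) - cis (of_int k * 0) / (\<i> * of_int k))) {0..2 * pi}"
  proof (rule fundamental_theorem_of_calculus)
    fix x :: real assume "x \<in> {0..2 * pi}"
    have "((\<lambda>z. exp (\<i> * of_int k * z) / (\<i> * of_int k)) has_field_derivative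
        exp (\<i> * of_int k * of_real x)) (at (of_real x))"
      using assms by (auto intro!: derivative_eq_intros)
    from has_vector_derivative_real_field[OF this, of "{0..2 * pi}"]
    show "((\<lambda>\<theta>. cis (of_int k * \<theta>) / (\<i> * of_int k)) has_vector_derivative cis (of_int k * x))
        (at x within {0..2 * pi})"
      by (simp add: cis_conv_exp mult.assoc)
  qed simp
  moreover have "cis (of_int k * (2 * pi)) = 1"
    using cis_multiple_2pi[of "of_int k"] by (simp add: mult_ac)
  ultimately show ?thesis by simp
qed

lemma continuous_on_poly_quotient_cis:
  fixes y w :: "complex poly"
  assumes "\<And>z. cmod z = 1 \<Longrightarrow> poly w z \<noteq> 0"
  shows "continuous_on X (\<lambda>\<theta>. poly y (cis \<theta>) / poly w (cis \<theta>))"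
  using assms by (intro continuous_intros) auto

text \<open>
  On the unit circle \<open>t\<^sup>-\<^sup>1 = cis (-\<theta>)\<close>. As a function of \<open>\<zeta> = t\<^sup>-\<^sup>1\<close>, the quotient
  \<open>y / w\<close> has no poles in the closed disc and vanishes at \<open>\<zeta> = 0\<close>, so it expands into
  positive powers of \<open>\<zeta>\<close>, that is, into negative powers of \<open>t\<close>.
\<close>
lemma strictly_proper_fourier_eq_0:
  fixes y w :: "complex poly" and j :: nat
  assumes nz: "\<And>z. 1 \<le> cmod z \<Longrightarrow> poly w z \<noteq> 0" and deg: "degree y < degree w"
  shows "integral {0..2 * pi} (\<lambda>\<theta>. poly y (cis \<theta>) / poly w (cis \<theta>) * cis (- (of_nat j * \<theta>))) = 0"
    (is "integral ?I ?f = 0")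
proof -
  \<comment> \<open>The order of vanishing at infinity is \<open>d + 1\<close>; one factor \<open>\<zeta>\<close> is kept apart in \<open>f_eq\<close>, so
    that only powers \<open>\<zeta>\<^bsup>k + 1\<^esup>\<close> occur when the rest is replaced by a Taylor polynomial.\<close>
  define d where "d = degree w - degree y - 1"
  let ?u = "monom 1 (d + j) * reflect_poly y" and ?v = "reflect_poly w"
  have w0: "w \<noteq> 0" using deg by auto
  have v_nz: "poly ?v z \<noteq> 0" if "cmod z \<le> 1" for z
  proof (cases "z = 0")
    case True
    then show ?thesis using w0 by simp
  next
    case False
    then have "1 \<le> cmod (inverse z)"
      using that by (simp add: norm_inverse one_le_inverse)
    then show ?thesis using False nz by (simp add: poly_reflect_poly_nz)
  qed
  obtain \<rho> where \<rho>: "0 < \<rho>" "\<rho> < 1"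
    "\<And>u. \<exists>a C. 0 \<le> C \<and> (\<forall>n z. cmod z \<le> 1 \<longrightarrow>
        cmod (poly u z / poly ?v z - (\<Sum>k<n. a k * z ^ k)) \<le> C * \<rho> ^ n)"
    using rational_taylor_geometric[OF v_nz] by metis
  obtain a C where aC: "0 \<le> C" "\<And>n z. cmod z \<le> 1 \<Longrightarrow>
        cmod (poly ?u z / poly ?v z - (\<Sum>k<n. a k * z ^ k)) \<le> C * \<rho> ^ n"
    using \<rho>(3)[of ?u] by blast
  have cancel: "z * (z ^ (d + j + e) * Y / (z ^ (d + e + 1) * W)) = z ^ j * (Y / W)"
    if "z \<noteq> 0" for z Y W :: complex and e
  proof -
    have "z * (z ^ (d + j + e) * Y / (z ^ (d + e + 1) * W))
        = (z ^ (d + e + 1) * (z ^ j * Y)) / (z ^ (d + e + 1) * W)"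
      by (simp add: power_add mult_ac)
    also have "\<dots> = z ^ j * Y / W"
      using that by (intro mult_divide_mult_cancel_left) auto
    finally show ?thesis by simp
  qed
  have f_eq: "?f \<theta> = cis (-\<theta>) * (poly ?u (cis (-\<theta>)) / poly ?v (cis (-\<theta>)))" for \<theta>
  proof -
    let ?z = "cis (-\<theta>)"
    have inv: "inverse ?z = cis \<theta>" by simp
    have z0: "?z \<noteq> 0" by simp
    have "poly ?u ?z = ?z ^ (d + j + degree y) * poly y (cis \<theta>)"
      unfolding poly_mult poly_monom poly_reflect_poly_nz[OF z0] inv by (simp add: power_add mult_ac)
    moreover have "poly ?v ?z = ?z ^ (d + degree y + 1) * poly w (cis \<theta>)"
      unfolding poly_reflect_poly_nz[OF z0] inv using deg by (simp add: d_def)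
    ultimately have "?z * (poly ?u ?z / poly ?v ?z) = ?z ^ j * (poly y (cis \<theta>) / poly w (cis \<theta>))"
      using cancel[OF z0] by simp
    moreover have "?z ^ j = cis (- (of_nat j * \<theta>))"
      by (simp add: Complex.DeMoivre)
    ultimately show ?thesis by (simp add: mult_ac)
  qed
  have cont: "continuous_on ?I ?f"
    using nz by (intro continuous_intros continuous_on_poly_quotient_cis) auto
  have bound: "cmod (integral ?I ?f) \<le> 2 * pi * C * \<rho> ^ n" for n
  proof -
    let ?g = "\<lambda>\<theta>. \<Sum>k<n. a k * cis (of_int (- int (Suc k)) * \<theta>)"
    have "(?g has_integral (\<Sum>k<n. a k * 0)) ?I"
      by (intro has_integral_sum has_integral_mult_right integral_cis_eq_0) auto
    then have g: "?g integrable_on ?I" "integral ?I ?g = 0"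
      by (auto simp: has_integral_iff)
    have g_eq: "?g \<theta> = cis (-\<theta>) * (\<Sum>k<n. a k * cis (-\<theta>) ^ k)" for \<theta>
      unfolding sum_distrib_left
      by (intro sum.cong refl) (simp add: Complex.DeMoivre cis_mult algebra_simps)
    have diff: "integral ?I ?f = integral ?I (\<lambda>\<theta>. ?f \<theta> - ?g \<theta>)"
      using g integrable_continuous_real[OF cont] by (subst integral_diff) auto
    have le: "cmod (?f \<theta> - ?g \<theta>) \<le> C * \<rho> ^ n" for \<theta>
      unfolding f_eq g_eq right_diff_distrib[symmetric] norm_mult
      using aC(2)[of "cis (-\<theta>)" n] by simp
    have "continuous_on ?I (\<lambda>\<theta>. ?f \<theta> - ?g \<theta>)"
      by (intro continuous_intros cont)
    then have "cmod (integral ?I (\<lambda>\<theta>. ?f \<theta> - ?g \<theta>)) \<le> (C * \<rho> ^ n) * (2 * pi - 0)"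
      using le by (intro integral_bound) auto
    then show ?thesis unfolding diff by (simp add: mult_ac)
  qed
  have "(\<lambda>n. 2 * pi * C * \<rho> ^ n) \<longlonglongrightarrow> 2 * pi * C * 0"
    using \<rho> by (intro tendsto_mult_left LIMSEQ_power_zero) auto
  then have "cmod (integral ?I ?f) \<le> 2 * pi * C * 0"
    by (rule LIMSEQ_le_const) (intro exI allI impI bound)
  then show ?thesis by simp
qed

section \<open>Block Toeplitz matrices and convolution\<close>

lemma sum_div_mod:
  fixes g :: "nat \<Rightarrow> nat \<Rightarrow> 'a::comm_monoid_add"
  assumes "0 < N"
  shows "(\<Sum>y<n * N. g (y mod N) (y div N)) = (\<Sum>k<n. \<Sum>b<N. g b k)"
proof -
  have "(\<Sum>y<n * N. g (y mod N) (y div N)) = (\<Sum>k<n. \<Sum>y = k * N..<k * N + N. g (y mod N) (y div N))"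
    by (rule sum.nat_group[symmetric])
  also have "\<dots> = (\<Sum>k<n. \<Sum>b<N. g b k)"
  proof (rule sum.cong[OF refl])
    fix k
    have "(\<Sum>y = 0 + k * N..<N + k * N. g (y mod N) (y div N))
        = (\<Sum>b = 0..<N. g ((b + k * N) mod N) ((b + k * N) div N))"
      by (rule sum.shift_bounds_nat_ivl)
    also have "\<dots> = (\<Sum>b<N. g b k)"
      unfolding atLeast0LessThan using assms by (intro sum.cong) auto
    finally show "(\<Sum>y = k * N..<k * N + N. g (y mod N) (y div N)) = (\<Sum>b<N. g b k)"
      by (simp add: add.commute)
  qed
  finally show ?thesis .
qed

lemma block_toeplitz_carrier: "block_toeplitz N n A \<in> carrier_mat (n * N) (n * N)"
  by (simp add: block_toeplitz_def)

text \<open>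
  A block Toeplitz matrix acts by multiplication with the symbol followed by taking Fourier
  coefficients. The vector holds the coefficients of \<open>N\<close> polynomials of degree below \<open>n\<close>.
\<close>
lemma block_toeplitz_mult_vec_index:
  assumes N: "0 < N" and x: "x < n * N"
    and cont: "\<And>a b. a < N \<Longrightarrow> b < N \<Longrightarrow> continuous_on {0..2 * pi} (\<lambda>\<theta>. A (cis \<theta>) $$ (a, b))"
  shows "(block_toeplitz N n A *\<^sub>v vec (n * N) (\<lambda>y. c (y mod N) (y div N))) $ x =
    integral {0..2 * pi} (\<lambda>\<theta>. (\<Sum>b<N. A (cis \<theta>) $$ (x mod N, b) * (\<Sum>k<n. c b k * cis \<theta> ^ k))
      * cis (- (of_nat (x div N) * \<theta>))) / of_real (2 * pi)" (is "?lhs = integral ?I ?f / _")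
proof -
  let ?a = "x mod N" and ?j = "x div N"
  let ?F = "\<lambda>b k. fourier_coeff N A (int ?j - int k) $$ (?a, b)"
  let ?h = "\<lambda>b k \<theta>. A (cis \<theta>) $$ (?a, b) * cis (- (of_int (int ?j - int k) * \<theta>))"
  have a: "?a < N" using N by simp
  have "?lhs = (\<Sum>y<n * N. ?F (y mod N) (y div N) * c (y mod N) (y div N))"
    using x by (simp add: block_toeplitz_def scalar_prod_def atLeast0LessThan)
  also have "\<dots> = (\<Sum>k<n. \<Sum>b<N. ?F b k * c b k)"
    by (rule sum_div_mod[OF N, of "\<lambda>b k. ?F b k * c b k"])
  finally have lhs: "?lhs = (\<Sum>k<n. \<Sum>b<N. ?F b k * c b k)" .
  have "(?h b k has_integral of_real (2 * pi) * ?F b k) ?I" if b: "b < N" for b k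
  proof -
    have "?h b k integrable_on ?I"
      by (intro integrable_continuous_real continuous_intros cont a b)
    then show ?thesis
      using a b by (simp add: fourier_coeff_def has_integral_iff)
  qed
  then have "((\<lambda>\<theta>. \<Sum>k<n. \<Sum>b<N. ?h b k \<theta> * c b k) has_integral
      (\<Sum>k<n. \<Sum>b<N. of_real (2 * pi) * ?F b k * c b k)) ?I"
    by (intro has_integral_sum has_integral_mult_left) auto
  moreover have "(\<Sum>k<n. \<Sum>b<N. ?h b k \<theta> * c b k) = ?f \<theta>" for \<theta>
  proof -
    have shift: "cis \<theta> ^ k * cis (- (of_nat ?j * \<theta>)) = cis (- (of_int (int ?j - int k) * \<theta>))" for k
      by (simp add: Complex.DeMoivre cis_mult algebra_simps)
    have "?f \<theta> = (\<Sum>b<N. \<Sum>k<n. A (cis \<theta>) $$ (?a, b) * (cis \<theta> ^ k * cis (- (of_nat ?j * \<theta>))) * c b k)"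
      by (simp add: sum_distrib_left sum_distrib_right mult_ac)
    also have "\<dots> = (\<Sum>k<n. \<Sum>b<N. ?h b k \<theta> * c b k)"
      unfolding shift by (rule sum.swap)
    finally show ?thesis by simp
  qed
  ultimately have "(?f has_integral (\<Sum>k<n. \<Sum>b<N. of_real (2 * pi) * ?F b k * c b k)) ?I"
    by simp
  then have "integral ?I ?f = (\<Sum>k<n. \<Sum>b<N. of_real (2 * pi) * ?F b k * c b k)"
    by (rule integral_unique)
  then have "integral ?I ?f = of_real (2 * pi) * ?lhs"
    unfolding lhs by (simp add: sum_distrib_left mult_ac)
  then show ?thesis by simp
qed

text \<open>
  If the Fourier coefficients of \<open>A f\<close> of nonnegative index vanish, then replacing \<open>f\<close> by
  polynomials \<open>p\<close> of degree below \<open>n\<close> leaves those of \<open>- A (f - p)\<close>, which are controlled by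
  the uniform distance \<open>\<epsilon>\<close> of \<open>f\<close> and \<open>p\<close> on the circle.
\<close>
lemma toeplitz_truncated_kernel_small:
  assumes N: "0 < N"
    and cont: "\<And>a b. a < N \<Longrightarrow> b < N \<Longrightarrow> continuous_on {0..2 * pi} (\<lambda>\<theta>. A (cis \<theta>) $$ (a, b))"
    and K: "\<And>a b \<theta>. a < N \<Longrightarrow> b < N \<Longrightarrow> cmod (A (cis \<theta>) $$ (a, b)) \<le> K"
    and cont_f: "\<And>b. b < N \<Longrightarrow> continuous_on {0..2 * pi} (\<lambda>\<theta>. f b (cis \<theta>))"
    and approx: "\<And>b \<theta>. b < N \<Longrightarrow> cmod (f b (cis \<theta>) - (\<Sum>k<n. c b k * cis \<theta> ^ k)) \<le> \<epsilon>"
    and kernel: "\<And>a j. a < N \<Longrightarrow>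
      integral {0..2 * pi} (\<lambda>\<theta>. (\<Sum>b<N. A (cis \<theta>) $$ (a, b) * f b (cis \<theta>)) * cis (- (of_nat j * \<theta>))) = 0"
  shows "euclid_norm (block_toeplitz N n A *\<^sub>v vec (n * N) (\<lambda>y. c (y mod N) (y div N)))
    \<le> real (n * N) * (real N * (K * \<epsilon>))" (is "euclid_norm ?w \<le> _")
proof -
  let ?I = "{0..2 * pi}"
  have K0: "0 \<le> K" using K[OF N N] norm_ge_zero order_trans by blast
  have entry: "cmod (?w $ x) \<le> real N * (K * \<epsilon>)" if x: "x < n * N" for x
  proof -
    let ?a = "x mod N" and ?j = "x div N"
    let ?A = "\<lambda>\<theta> b. A (cis \<theta>) $$ (?a, b)"
    let ?p = "\<lambda>\<theta> b. \<Sum>k<n. c b k * cis \<theta> ^ k"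
    let ?e = "\<lambda>\<theta>. cis (- (of_nat ?j * \<theta>))"
    let ?g = "\<lambda>\<theta>. (\<Sum>b<N. ?A \<theta> b * (f b (cis \<theta>) - ?p \<theta> b)) * ?e \<theta>"
    have a: "?a < N" using N by simp
    have cont_g: "continuous_on ?I ?g" and
      cont_0: "continuous_on ?I (\<lambda>\<theta>. (\<Sum>b<N. ?A \<theta> b * f b (cis \<theta>)) * ?e \<theta>)"
      by (auto intro!: continuous_intros cont cont_f a)
    have "(\<Sum>b<N. ?A \<theta> b * ?p \<theta> b) * ?e \<theta> = (\<Sum>b<N. ?A \<theta> b * f b (cis \<theta>)) * ?e \<theta> - ?g \<theta>" for \<theta>
      by (simp add: right_diff_distrib sum_subtractf left_diff_distrib)
    then have "integral ?I (\<lambda>\<theta>. (\<Sum>b<N. ?A \<theta> b * ?p \<theta> b) * ?e \<theta>) = - integral ?I ?g"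
      using integral_diff[OF integrable_continuous_real[OF cont_0] integrable_continuous_real[OF cont_g]]
        kernel[OF a, of ?j] by simp
    moreover have "cmod (integral ?I ?g) \<le> (real N * (K * \<epsilon>)) * (2 * pi - 0)"
    proof -
      have "cmod (?g \<theta>) \<le> real N * (K * \<epsilon>)" for \<theta>
      proof -
        have "cmod (?g \<theta>) = cmod (\<Sum>b<N. ?A \<theta> b * (f b (cis \<theta>) - ?p \<theta> b))"
          by (simp add: norm_mult)
        also have "\<dots> \<le> (\<Sum>b<N. K * \<epsilon>)"
          unfolding norm_mult
          by (rule sum_norm_le) (auto simp: norm_mult intro!: mult_mono K approx a K0)
        finally show ?thesis by simp
      qed
      then show ?thesis
        using cont_g by (intro integral_bound) auto
    qed
    moreover have "?w $ x = integral ?I (\<lambda>\<theta>. (\<Sum>b<N. ?A \<theta> b * ?p \<theta> b) * ?e \<theta>) / of_real (2 * pi)"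
      by (rule block_toeplitz_mult_vec_index[OF N x cont])
    ultimately have "cmod (?w $ x) * (2 * pi) \<le> (real N * (K * \<epsilon>)) * (2 * pi)"
      by (simp only: norm_divide norm_minus_cancel norm_of_real) simp
    then show ?thesis by (rule mult_right_le_imp_le) simp
  qed
  have "euclid_norm ?w \<le> (\<Sum>x<n * N. cmod (?w $ x))"
    using euclid_norm_le_sum[of ?w] by (simp add: block_toeplitz_def)
  also have "\<dots> \<le> (\<Sum>x<n * N. real N * (K * \<epsilon>))"
    by (rule sum_mono) (use entry in auto)
  finally show ?thesis by simp
qed

text \<open>
  The factor \<open>n\<close>, which stems from the dimension of the matrices, is absorbed by passing from
  \<open>\<rho>\<close> to \<open>\<sigma> = \<surd>\<rho>\<close>. The finitely many \<open>n < m\<close> are covered by \<open>1 \<le> \<kappa>(M)\<close> once the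
  constant is at most \<open>\<sigma>\<^bsup>m\<^esup>\<close>.
\<close>
lemma exponential_growth_of_condition_number:
  fixes T :: "nat \<Rightarrow> complex mat"
  assumes N: "0 < N" and T: "\<And>n. T n \<in> carrier_mat (n * N) (n * N)"
    and \<rho>: "0 < \<rho>" "\<rho> < 1" and pos: "0 < \<delta>" "0 < \<eta>" and D: "0 \<le> D"
    and u: "\<And>n. m \<le> n \<Longrightarrow> u n \<in> carrier_vec (n * N)" "\<And>n. m \<le> n \<Longrightarrow> euclid_norm (u n) = 1"
      "\<And>n. m \<le> n \<Longrightarrow> \<delta> \<le> euclid_norm (T n *\<^sub>v u n)"
    and v: "\<And>n. m \<le> n \<Longrightarrow> v n \<in> carrier_vec (n * N)" "\<And>n. m \<le> n \<Longrightarrow> \<eta> \<le> euclid_norm (v n)"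
      "\<And>n. m \<le> n \<Longrightarrow> euclid_norm (T n *\<^sub>v v n) \<le> D * real n * \<rho> ^ n"
  shows "\<exists>c>0. \<exists>\<gamma>>0. \<forall>n\<ge>1. condition_number (T n) \<ge> ereal (c * exp (\<gamma> * real n))"
proof -
  define \<sigma> where "\<sigma> = sqrt \<rho>"
  have \<sigma>: "0 < \<sigma>" "\<sigma> < 1" "\<rho> = \<sigma> * \<sigma>" using \<rho> by (auto simp: \<sigma>_def)
  have "(\<lambda>n. real n * \<sigma> ^ n) \<longlonglongrightarrow> 0"
    using \<sigma> by (intro powser_times_n_limit_0) auto
  then have "Bseq (\<lambda>n. real n * \<sigma> ^ n)"
    by (rule convergent_imp_Bseq[OF convergentI])
  then obtain E where E: "0 < E" "\<And>n. norm (real n * \<sigma> ^ n) \<le> E"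
    by (auto simp: Bseq_def)
  define D' where "D' = D * E + 1"
  have D': "0 < D'" using D E by (simp add: D'_def add_nonneg_pos)
  have small: "euclid_norm (T n *\<^sub>v v n) \<le> D' * \<sigma> ^ n" if "m \<le> n" for n
  proof -
    have "euclid_norm (T n *\<^sub>v v n) \<le> D * (real n * \<sigma> ^ n) * \<sigma> ^ n"
      using v(3)[OF that] \<sigma>(3) by (simp add: power_mult_distrib mult_ac)
    also have "\<dots> \<le> D * E * \<sigma> ^ n"
      using E(2)[of n] D \<sigma> by (intro mult_right_mono mult_left_mono) auto
    also have "\<dots> \<le> D' * \<sigma> ^ n" using \<sigma> by (simp add: D'_def algebra_simps)
    finally show ?thesis .
  qed
  define c where "c = min (\<delta> * \<eta> / D') (\<sigma> ^ m)"
  have c: "0 < c" "c \<le> \<delta> * \<eta> / D'" "c \<le> \<sigma> ^ m"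
    using pos D' \<sigma> by (auto simp: c_def)
  have \<gamma>: "0 < - ln \<sigma>" using \<sigma> by simp
  have exp_eq: "exp (- ln \<sigma> * real n) = 1 / \<sigma> ^ n" for n
  proof -
    have "exp (- ln \<sigma> * real n) = exp (- ln \<sigma>) ^ n"
      by (subst exp_of_nat2_mult) simp
    also have "exp (- ln \<sigma>) = 1 / \<sigma>" using \<sigma> by (simp add: exp_minus inverse_eq_divide)
    finally show ?thesis by (simp add: power_one_over)
  qed
  have "ereal (c * exp (- ln \<sigma> * real n)) \<le> condition_number (T n)" if n: "1 \<le> n" for n
  proof (cases "m \<le> n")
    case False
    have "c \<le> \<sigma> ^ n"
      using False \<sigma> by (intro order_trans[OF c(3)] power_decreasing) auto
    then have "c * exp (- ln \<sigma> * real n) \<le> 1"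
      unfolding exp_eq using \<sigma> by (simp add: divide_simps)
    then have "ereal (c * exp (- ln \<sigma> * real n)) \<le> 1" by (simp add: one_ereal_def)
    also have "1 \<le> condition_number (T n)"
      using N n by (intro condition_number_ge_1[OF T]) auto
    finally show ?thesis .
  next
    case m: True
    show ?thesis
    proof (cases "invertible_mat (T n)")
      case False
      then show ?thesis by (simp add: condition_number_def)
    next
      case inv: True
      have u0: "u n \<noteq> 0\<^sub>v (n * N)" and v0: "v n \<noteq> 0\<^sub>v (n * N)"
        using u(2)[OF m] v(2)[OF m] pos by (auto simp: euclid_norm_def L2_set_def)
      note ratio = condition_number_ge_ratio[OF T inv u(1)[OF m] u0 v(1)[OF m] v0]
      have "c * exp (- ln \<sigma> * real n) \<le> \<delta> * \<eta> / D' * (1 / \<sigma> ^ n)"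
        unfolding exp_eq using c \<sigma> by (intro mult_right_mono) auto
      also have "\<dots> = \<delta> * \<eta> / (D' * \<sigma> ^ n)" by simp
      also have "\<dots> \<le> euclid_norm (T n *\<^sub>v u n) * euclid_norm (v n) / euclid_norm (T n *\<^sub>v v n)"
        using u(3)[OF m] v(2)[OF m] small[OF m] ratio(1) pos
        by (intro frac_le mult_mono) (auto simp: euclid_norm_nonneg)
      finally have "ereal (c * exp (- ln \<sigma> * real n))
          \<le> ereal (euclid_norm (T n *\<^sub>v u n) * euclid_norm (v n) / (euclid_norm (u n) * euclid_norm (T n *\<^sub>v v n)))"
        using u(2)[OF m] by simp
      also note ratio(2)
      finally show ?thesis .
    qed
  qed
  then show ?thesis using c(1) \<gamma> by blast
qed

section \<open>The annihilating column of the Smith form\<close>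

lemma unimodular_right_inverse:
  fixes G :: "complex poly mat"
  assumes G: "G \<in> carrier_mat N N" and det: "det G = [:c:]" "c \<noteq> 0"
  obtains G' where "G' \<in> carrier_mat N N" "G * G' = 1\<^sub>m N"
proof
  have one: "[:1 / c:] * [:c:] = 1" using det by (simp add: one_pCons)
  show "[:1 / c:] \<cdot>\<^sub>m adj_mat G \<in> carrier_mat N N" using adj_mat(1)[OF G] by simp
  have "G * ([:1 / c:] \<cdot>\<^sub>m adj_mat G) = [:1 / c:] \<cdot>\<^sub>m (det G \<cdot>\<^sub>m 1\<^sub>m N)"
    using mult_smult_distrib[OF G adj_mat(1)[OF G]] adj_mat(2)[OF G] by simp
  also have "\<dots> = ([:1 / c:] * [:c:]) \<cdot>\<^sub>m 1\<^sub>m N"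
    unfolding det(1) by (intro eq_matI) (auto simp: mult.assoc)
  finally show "G * ([:1 / c:] \<cdot>\<^sub>m adj_mat G) = 1\<^sub>m N" unfolding one by auto
qed

text \<open>
  The last diagonal polynomial annihilates the cokernel of \<open>S\<close>: the diagonal matrix times
  \<open>diag(p\<^sub>N / p\<^sub>j)\<close> is scalar, hence commutes with the unimodular factors.
\<close>
lemma smith_last_annihilates:
  assumes smith: "is_smith_form N S p" and N: "0 < N"
  obtains B where "B \<in> carrier_mat N N" "S * B = p (N - 1) \<cdot>\<^sub>m 1\<^sub>m N"
proof -
  obtain G H c d where G: "G \<in> carrier_mat N N" "det G = [:c:]" "c \<noteq> 0"
    and H: "H \<in> carrier_mat N N" "det H = [:d:]" "d \<noteq> 0"
    and S: "S = G * mat_diag N p * H" and dvd: "\<And>j. Suc j < N \<Longrightarrow> p j dvd p (Suc j)"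
    using smith unfolding is_smith_form_def by blast
  have dvd_last: "p j dvd p (N - 1)" if "j < N" for j
  proof -
    have "j \<le> N - 1" using that by simp
    then show ?thesis
    proof (induction rule: inc_induct)
      case (step m)
      then have "p m dvd p (Suc m)" by (intro dvd) simp
      then show ?case using step.IH by (rule dvd_trans)
    qed simp
  qed
  obtain G' where G': "G' \<in> carrier_mat N N" "G * G' = 1\<^sub>m N"
    using unimodular_right_inverse[OF G] .
  obtain H' where H': "H' \<in> carrier_mat N N" "H * H' = 1\<^sub>m N"
    using unimodular_right_inverse[OF H] .
  define D where "D = mat_diag N p"
  define E where "E = mat_diag N (\<lambda>j. p (N - 1) div p j)"
  have D: "D \<in> carrier_mat N N" and E: "E \<in> carrier_mat N N" by (auto simp: D_def E_def)
  have DE: "D * E = p (N - 1) \<cdot>\<^sub>m 1\<^sub>m N"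
    unfolding D_def E_def mat_diag_diag
    using dvd_last by (intro eq_matI) (auto simp: mat_diag_def)
  note cs = G(1) G'(1) H(1) H'(1) D E
  have "S * (H' * E * G') = G * D * (H * H') * E * G'"
    unfolding S D_def[symmetric] using cs
    by (simp add: assoc_mult_mat[of _ N N _ N _ N] mult_carrier_mat[of _ N N _ N])
  also have "\<dots> = G * (D * E) * G'"
    using cs H'(2) by (simp add: assoc_mult_mat[of _ N N _ N _ N] mult_carrier_mat[of _ N N _ N])
  also have "\<dots> = p (N - 1) \<cdot>\<^sub>m (G * G')"
    unfolding DE using cs
    by (simp add: mult_smult_distrib[of _ N N _ N] mult_smult_assoc_mat[of _ N N _ N])
  finally have "S * (H' * E * G') = p (N - 1) \<cdot>\<^sub>m 1\<^sub>m N"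
    unfolding G'(2) .
  moreover have "H' * E * G' \<in> carrier_mat N N" using cs by auto
  ultimately show ?thesis using that by blast
qed

text \<open>
  This clears denominators: \<open>r\<^sup>+ = v / u\<close>, and \<open>y / w\<close> collects the remaining factors of
  \<open>P / q\<close>. As \<open>r\<^sup>-\<close> has neither a zero nor a pole at infinity, its numerator and denominator
  have the same degree, so the degree of \<open>y / w\<close> is the sum of the other exponents.
\<close>
lemma negative_index_splitting:
  fixes P q :: "complex poly" and t :: "nat \<Rightarrow> complex" and \<beta> :: "nat \<Rightarrow> nat" and \<kappa> :: int and r :: nat
  assumes q: "q \<noteq> 0"
    and fac: "to_fract P / to_fract q =
        (\<Prod>i<r. to_fract [:- t i, 1:] ^ \<beta> i) * to_fract [:0, 1:] powi \<kappa> * rminus * rplus"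
    and minus: "minus_factor rminus" and plus: "plus_factor rplus"
    and neg: "(\<Sum>i<r. int (\<beta> i)) + \<kappa> < 0"
  obtains u v y w where
    "\<And>z. cmod z \<le> 1 \<Longrightarrow> poly u z \<noteq> 0" "\<And>z. cmod z \<le> 1 \<Longrightarrow> poly v z \<noteq> 0"
    "\<And>z. 1 \<le> cmod z \<Longrightarrow> poly w z \<noteq> 0" "degree y < degree w" "P * u * w = q * v * y"
proof -
  define v where "v = fst (quot_of_fract rplus)"
  define u where "u = snd (quot_of_fract rplus)"
  define a where "a = fst (quot_of_fract rminus)"
  define b where "b = snd (quot_of_fract rminus)"
  have rp: "rplus = to_fract v / to_fract u" and rm: "rminus = to_fract a / to_fract b"
    unfolding u_def v_def a_def b_def by (simp_all flip: Fract_conv_to_fract)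
  have nz: "u \<noteq> 0" "b \<noteq> 0" unfolding u_def b_def by auto
  have deg_ab: "degree a = degree b"
    using minus unfolding minus_factor_def ratfun_zero_infinity_def ratfun_pole_infinity_def a_def b_def
    by auto
  \<comment> \<open>One of \<open>nat \<kappa>\<close> and \<open>nat (- \<kappa>)\<close> is \<open>0\<close>; the other moves the power of \<open>t\<close> to the side where
    its exponent is nonnegative.\<close>
  define y where "y = (\<Prod>i<r. [:- t i, 1:] ^ \<beta> i) * [:0, 1:] ^ nat \<kappa> * a"
  define w where "w = [:0, 1:] ^ nat (- \<kappa>) * b"
  let ?X = "to_fract [:0, 1 :: complex:]"
  have X0: "?X \<noteq> 0" by simp
  have Xp: "?X powi \<kappa> * ?X ^ nat (- \<kappa>) = ?X ^ nat \<kappa>"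
  proof (cases "0 \<le> \<kappa>")
    case False
    then show ?thesis using X0 by (simp add: power_int_def field_simps)
  qed (simp add: power_int_def)
  have to_fract_power: "to_fract (f ^ k) = to_fract f ^ k" for f :: "complex poly" and k
    by (induction k) auto
  have to_fract_prod: "to_fract (\<Prod>i<r. f i) = (\<Prod>i<r. to_fract (f i))" for f :: "nat \<Rightarrow> complex poly"
    by (induction r) auto
  show ?thesis
  proof
    show "poly u z \<noteq> 0" "poly v z \<noteq> 0" if "cmod z \<le> 1" for z
      using plus that unfolding plus_factor_def ratfun_zero_def ratfun_pole_def u_def v_def by auto
    show "poly w z \<noteq> 0" if "1 \<le> cmod z" for z
    proof -
      have "poly b z \<noteq> 0"
        using minus that unfolding minus_factor_def ratfun_pole_def b_def by auto
      moreover have "z \<noteq> 0" using that by auto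
      ultimately show ?thesis by (simp add: w_def)
    qed
    have "degree y \<le> degree ((\<Prod>i<r. [:- t i, 1:] ^ \<beta> i) * [:0, 1:] ^ nat \<kappa>) + degree a"
      unfolding y_def by (rule degree_mult_le)
    also have "\<dots> \<le> degree (\<Prod>i<r. [:- t i, 1:] ^ \<beta> i) + degree ([:0, 1 :: complex:] ^ nat \<kappa>) + degree a"
      by (intro add_right_mono degree_mult_le)
    also have "degree (\<Prod>i<r. [:- t i, 1:] ^ \<beta> i) = (\<Sum>i<r. \<beta> i)"
      by (subst degree_prod_eq_sum_degree) (auto simp: degree_linear_power degree_power_eq)
    also have "degree ([:0, 1 :: complex:] ^ nat \<kappa>) = nat \<kappa>"
      by (simp add: degree_power_eq)
    also have "(\<Sum>i<r. \<beta> i) + nat \<kappa> + degree a < nat (- \<kappa>) + degree b"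
    proof -
      have "int (\<Sum>i<r. \<beta> i) + \<kappa> < 0" using neg by simp
      then have "(\<Sum>i<r. \<beta> i) + nat \<kappa> < nat (- \<kappa>)" by linarith
      then show ?thesis using deg_ab by simp
    qed
    also have "\<dots> = degree w"
      using nz by (simp add: w_def degree_mult_eq degree_power_eq)
    finally show "degree y < degree w" .
    have "to_fract P = to_fract q * ((\<Prod>i<r. to_fract [:- t i, 1:] ^ \<beta> i) * ?X powi \<kappa> * rminus * rplus)"
      using fac q by (simp add: field_simps)
    then have "to_fract P * to_fract u * (?X ^ nat (- \<kappa>) * to_fract b)
        = to_fract q * (\<Prod>i<r. to_fract [:- t i, 1:] ^ \<beta> i) * (?X powi \<kappa> * ?X ^ nat (- \<kappa>))
          * (rminus * to_fract b) * (rplus * to_fract u)"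
      by (simp add: mult_ac)
    also have "rminus * to_fract b = to_fract a" using nz by (simp add: rm)
    also have "rplus * to_fract u = to_fract v" using nz by (simp add: rp)
    finally have "to_fract (P * u * w) = to_fract (q * v * y)"
      unfolding Xp w_def y_def by (simp add: to_fract_power to_fract_prod mult_ac)
    then show "P * u * w = q * v * y" by (rule to_fract_eq_iff[THEN iffD1])
  qed
qed

section \<open>Exponential growth\<close>

theorem theorem3p8:
  fixes N r :: nat
    and S :: "complex poly mat"
    and q :: "complex poly"
    and A :: "complex \<Rightarrow> complex mat"
    and p :: "nat \<Rightarrow> complex poly"
    and t :: "nat \<Rightarrow> complex"
    and \<beta> :: "nat \<Rightarrow> nat \<Rightarrow> nat"
    and \<kappa> :: "nat \<Rightarrow> int"
    and rminus rplus :: "nat \<Rightarrow> complex poly fract"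
  assumes "N \<ge> 1"
    and "S \<in> carrier_mat N N"
    and "det S \<noteq> 0"
    and "\<And>z. cmod z = 1 \<Longrightarrow> poly q z \<noteq> 0"
    and "A = (\<lambda>z. (1 / poly q z) \<cdot>\<^sub>m map_mat (\<lambda>f. poly f z) S)"
    and "is_smith_form N S p"
    and "inj_on t {..<r}"
    and "t ` {..<r} = {z. cmod z = 1 \<and> det (A z) = 0}"
    and "\<And>j. j < N \<Longrightarrow>
      to_fract (p j) / to_fract q =
        (\<Prod>i<r. to_fract [:- t i, 1:] ^ \<beta> j i) * to_fract [:0, 1:] powi \<kappa> j * rminus j * rplus j"
    and "\<And>j. j < N \<Longrightarrow> minus_factor (rminus j)"
    and "\<And>j. j < N \<Longrightarrow> plus_factor (rplus j)"
    and "(\<Sum>i<r. int (\<beta> (N - 1) i)) + \<kappa> (N - 1) < 0"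
  shows "\<exists>c>0. \<exists>\<gamma>>0. \<forall>n\<ge>1.
    condition_number (block_toeplitz N n A) \<ge> ereal (c * exp (\<gamma> * real n))"
proof -
  let ?I = "{0..2 * pi}"
  define P where "P = p (N - 1)"
  have N: "0 < N" and N1: "N - 1 < N" using assms(1) by auto
  have S: "S \<in> carrier_mat N N" and qnz: "\<And>z. cmod z = 1 \<Longrightarrow> poly q z \<noteq> 0" by fact+
  have q0: "q \<noteq> 0" using qnz[of 1] by auto
  have P0: "P \<noteq> 0"
    using assms(6) N1 by (auto simp: is_smith_form_def P_def)
  have A: "A z $$ (a, b) = poly (S $$ (a, b)) z / poly q z" if "a < N" "b < N" for a b z
    using that S unfolding assms(5) by simp
  obtain B where B: "B \<in> carrier_mat N N" "S * B = P \<cdot>\<^sub>m 1\<^sub>m N"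
    using smith_last_annihilates[OF assms(6) N] unfolding P_def .
  define x where "x b = B $$ (b, 0)" for b
  have Sx: "(\<Sum>b<N. S $$ (a, b) * x b) = (if a = 0 then P else 0)" if a: "a < N" for a
  proof -
    have "(S * B) $$ (a, 0) = (\<Sum>b<N. S $$ (a, b) * x b)"
      using a N S B(1) by (simp add: scalar_prod_def x_def atLeast0LessThan)
    then show ?thesis unfolding B(2) using a N by auto
  qed
  obtain u v y w where
    u: "\<And>z. cmod z \<le> 1 \<Longrightarrow> poly u z \<noteq> 0" and v: "\<And>z. cmod z \<le> 1 \<Longrightarrow> poly v z \<noteq> 0"
    and w: "\<And>z. 1 \<le> cmod z \<Longrightarrow> poly w z \<noteq> 0" and deg: "degree y < degree w"
    and eq: "P * u * w = q * v * y"
    using negative_index_splitting[OF q0 assms(9)[OF N1] assms(10)[OF N1] assms(11)[OF N1] assms(12)]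
    unfolding P_def by metis
  define f where "f b z = poly (x b * u) z / poly v z" for b z
  have Af: "(\<Sum>b<N. A (cis \<theta>) $$ (a, b) * f b (cis \<theta>))
      = (if a = 0 then poly y (cis \<theta>) / poly w (cis \<theta>) else 0)" if a: "a < N" for a \<theta>
  proof -
    let ?z = "cis \<theta>"
    have nz: "poly q ?z \<noteq> 0" "poly v ?z \<noteq> 0" "poly w ?z \<noteq> 0" using qnz v w by simp_all
    have "(\<Sum>b<N. A ?z $$ (a, b) * f b ?z) = (\<Sum>b<N. poly (S $$ (a, b) * x b) ?z) * poly u ?z / (poly q ?z * poly v ?z)"
      unfolding sum_distrib_right sum_divide_distrib
      using a by (intro sum.cong) (auto simp: A f_def)
    also have "\<dots> = poly (if a = 0 then P else 0) ?z * poly u ?z / (poly q ?z * poly v ?z)"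
      by (simp only: Sx[OF a] flip: poly_sum)
    also have "\<dots> = (if a = 0 then poly y ?z / poly w ?z else 0)"
      using nz arg_cong[OF eq, of "\<lambda>h. poly h ?z"] by (auto simp: field_simps)
    finally show ?thesis .
  qed
  have kernel: "integral ?I (\<lambda>\<theta>. (\<Sum>b<N. A (cis \<theta>) $$ (a, b) * f b (cis \<theta>)) * cis (- (of_nat j * \<theta>))) = 0"
    if "a < N" for a j
    unfolding Af[OF that] using strictly_proper_fourier_eq_0[OF w deg, of j] by (cases "a = 0") simp_all
  have cont: "continuous_on ?I (\<lambda>\<theta>. A (cis \<theta>) $$ (a, b))" if "a < N" "b < N" for a b
    unfolding A[OF that] using qnz by (rule continuous_on_poly_quotient_cis)
  have cont_f: "continuous_on ?I (\<lambda>\<theta>. f b (cis \<theta>))" for b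
    unfolding f_def using v by (intro continuous_on_poly_quotient_cis) auto
  obtain K where K: "\<And>a b \<theta>. a < N \<Longrightarrow> b < N \<Longrightarrow> cmod (A (cis \<theta>) $$ (a, b)) \<le> K"
  proof -
    let ?g = "\<lambda>ab z. poly (S $$ ab) z / poly q z"
    have "bounded (\<Union>ab\<in>{..<N} \<times> {..<N}. ?g ab ` sphere 0 1)"
      using qnz by (intro bounded_UN ballI compact_imp_bounded compact_continuous_image continuous_intros) auto
    then obtain K where "\<forall>h\<in>(\<Union>ab\<in>{..<N} \<times> {..<N}. ?g ab ` sphere 0 1). cmod h \<le> K"
      unfolding bounded_iff by blast
    then show ?thesis by (intro that[of K]) (auto simp: A)
  qed
  have K0: "0 \<le> K" using K[OF N N] norm_ge_zero order_trans by blast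
  obtain \<rho> where \<rho>: "0 < \<rho>" "\<rho> < 1"
    "\<And>u. \<exists>a C. 0 \<le> C \<and> (\<forall>n z. cmod z \<le> 1 \<longrightarrow>
        cmod (poly u z / poly v z - (\<Sum>k<n. a k * z ^ k)) \<le> C * \<rho> ^ n)"
    using rational_taylor_geometric[OF v] by metis
  have "\<forall>b. \<exists>a C. 0 \<le> C \<and> (\<forall>n z. cmod z \<le> 1 \<longrightarrow>
      cmod (f b z - (\<Sum>k<n. a k * z ^ k)) \<le> C * \<rho> ^ n)"
    unfolding f_def using \<rho>(3) by blast
  then obtain c C where C0: "\<And>b. 0 \<le> C b"
    and taylor: "\<And>b n z. cmod z \<le> 1 \<Longrightarrow> cmod (f b z - (\<Sum>k<n. c b k * z ^ k)) \<le> C b * \<rho> ^ n"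
    by metis
  define C' where "C' = (\<Sum>b<N. C b)"
  have C': "0 \<le> C'" unfolding C'_def using C0 by (simp add: sum_nonneg)
  have approx: "cmod (f b (cis \<theta>) - (\<Sum>k<n. c b k * cis \<theta> ^ k)) \<le> C' * \<rho> ^ n" if "b < N" for b n \<theta>
  proof -
    have "C b \<le> C'" unfolding C'_def using that C0 by (intro member_le_sum) auto
    then have "C b * \<rho> ^ n \<le> C' * \<rho> ^ n" using \<rho> by (intro mult_right_mono) auto
    then show ?thesis using taylor[of "cis \<theta>" b n] by simp
  qed
  \<comment> \<open>A function whose Taylor coefficients all vanish is zero on the disc; but \<open>S x\<close> is nonzero and
    \<open>u\<close> has no zeros there, so some component of \<open>f\<close> is nonzero.\<close>
  have "\<exists>b<N. \<exists>k. c b k \<noteq> 0"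
  proof (rule ccontr)
    assume "\<not> ?thesis"
    then have c0: "c b k = 0" if "b < N" for b k using that by blast
    have "x b = 0" if b: "b < N" for b
    proof -
      have "poly (x b * u) z = 0" if z: "cmod z \<le> 1" for z
      proof -
        have "(\<lambda>n. C b * \<rho> ^ n) \<longlonglongrightarrow> C b * 0"
          using \<rho> by (intro tendsto_mult_left LIMSEQ_power_zero) auto
        moreover have "cmod (f b z) \<le> C b * \<rho> ^ n" for n
          using taylor[OF z, of b n] c0[OF b] by simp
        ultimately have "cmod (f b z) \<le> C b * 0"
          by (intro LIMSEQ_le_const) auto
        then show ?thesis using v[OF z] by (simp add: f_def)
      qed
      then have "cball 0 1 \<subseteq> {z. poly (x b * u) z = 0}" by (auto simp del: poly_mult)
      moreover have "infinite (cball 0 1 :: complex set)"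
        using islimpt_UNIV[of "0 :: complex"] by (auto simp: islimpt_eq_infinite_cball)
      ultimately have "x b * u = 0" using poly_roots_finite finite_subset by blast
      then show ?thesis using u[of 0] by auto
    qed
    then show False using Sx[OF N] P0 by simp
  qed
  then obtain b0 k0 where bk: "b0 < N" "c b0 k0 \<noteq> 0" by blast
  define vv where "vv n = vec (n * N) (\<lambda>y. c (y mod N) (y div N))" for n
  have vv_small: "euclid_norm (block_toeplitz N n A *\<^sub>v vv n) \<le> (real N * real N * K * C') * real n * \<rho> ^ n" for n
    unfolding vv_def
    using toeplitz_truncated_kernel_small[OF N cont K cont_f approx kernel, of n]
    by (simp add: mult_ac)
  have vv_large: "cmod (c b0 k0) \<le> euclid_norm (vv n)" if n: "k0 < n" for n
  proof -
    let ?i = "k0 * N + b0"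
    have "?i < Suc k0 * N" using bk by simp
    also have "\<dots> \<le> n * N" using n by (intro mult_right_mono) auto
    finally have i: "?i < n * N" .
    then have "vv n $ ?i = c b0 k0" using bk by (simp add: vv_def)
    then show ?thesis using cmod_index_le_euclid_norm[of ?i "vv n"] i by (simp add: vv_def)
  qed
  show ?thesis
  proof (cases "\<exists>n\<ge>1. invertible_mat (block_toeplitz N n A)")
    case False
    then have "\<forall>n\<ge>1. condition_number (block_toeplitz N n A) \<ge> ereal (1 * exp (1 * real n))"
      by (simp add: condition_number_def)
    then show ?thesis by (intro exI[of _ 1] conjI) auto
  next
    case True
    then obtain n1 where n1: "1 \<le> n1" and inv: "invertible_mat (block_toeplitz N n1 A)" by blast
    let ?T = "\<lambda>n. block_toeplitz N n A"
    have "\<exists>i<n1 * N. \<exists>j<n1 * N. ?T n1 $$ (i, j) \<noteq> 0"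
    proof (rule ccontr)
      assume "\<not> ?thesis"
      then have "?T n1 = 0\<^sub>m (n1 * N) (n1 * N)"
        using block_toeplitz_carrier[of N n1 A] by (intro eq_matI) auto
      then have "?T n1 *\<^sub>v unit_vec (n1 * N) 0 = 0\<^sub>v (n1 * N)" by auto
      moreover have "0 < euclid_norm (?T n1 *\<^sub>v unit_vec (n1 * N) 0)"
        using n1 N by (intro condition_number_ge_ratio(1)[OF block_toeplitz_carrier inv, of "unit_vec (n1 * N) 0"]) auto
      ultimately show False by (simp add: euclid_norm_def L2_set_def)
    qed
    then obtain i j where ij: "i < n1 * N" "j < n1 * N" "?T n1 $$ (i, j) \<noteq> 0" by blast
    \<comment> \<open>From this size on, the entry \<open>(i, j)\<close> lies in the matrix and \<open>c b0 k0\<close> in the vector.\<close>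
    let ?n0 = "max n1 (Suc k0)"
    have lt: "i < n * N" "j < n * N" if "?n0 \<le> n" for n
    proof -
      have "n1 * N \<le> n * N" using that by (intro mult_right_mono) auto
      then show "i < n * N" "j < n * N" using ij(1,2) by linarith+
    qed
    have u_large: "cmod (?T n1 $$ (i, j)) \<le> euclid_norm (?T n *\<^sub>v unit_vec (n * N) j)" if "?n0 \<le> n" for n
    proof -
      have "(?T n *\<^sub>v unit_vec (n * N) j) $ i = ?T n $$ (i, j)"
        using lt[OF that] block_toeplitz_carrier[of N n A] by simp
      also have "\<dots> = ?T n1 $$ (i, j)" using lt[OF that] ij by (simp add: block_toeplitz_def)
      finally show ?thesis
        using cmod_index_le_euclid_norm[of i "?T n *\<^sub>v unit_vec (n * N) j"] lt[OF that] block_toeplitz_carrier[of N n A]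
        by simp
    qed
    show ?thesis
    proof (rule exponential_growth_of_condition_number[OF N _ \<rho>(1,2),
          where T = ?T and m = ?n0 and u = "\<lambda>n. unit_vec (n * N) j" and v = vv])
      show "0 < cmod (?T n1 $$ (i, j))" "0 < cmod (c b0 k0)" using ij bk by auto
      show "0 \<le> real N * real N * K * C'" using K0 C' by simp
    qed (use lt u_large vv_large vv_small euclid_norm_unit_vec block_toeplitz_carrier in \<open>auto simp: vv_def\<close>)
  qed
qed

end
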